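(* Let $F$ be a singular fiber of Kodaira type $IV^*$ of an elliptic fibration on a smooth $K3$ surface, written $$F=3C+2(B_1+B_2+B_3)+B_1'+B_2'+B_3'.$$ Let $R$ be an ADER in $F$ with $C\subset\operatorname{Supp}(R)$. Let $\Gamma$ be the connected component of $R$ containing $C$, and write $$\Gamma=C+\sum_{i\,:\,m_i\geq1}B_i+\sum_{i\,:\,m_i=2}B_i',\qquad m_1,m_2,m_3\in\{0,1,2\},$$ and $R=\Gamma+B^{\mathrm{tail}}$, where $B^{\mathrm{tail}}$ is the remaining part of $R$. After renumbering the three branches if necessary, assume $m_1\leq m_2\leq m_3$. Then $(m_1,m_2,m_3)\neq(2,2,2)$, and $\Gamma$ is of type $$\begin{cases}A_{1+m_1+m_2+m_3},&\text{if at most two of }m_1,m_2,m_3\text{ are nonzero},\\ D_4,&\text{if }(m_1,m_2,m_3)=(1,1,1),\\ D_5,&\text{if }(m_1,m_2,m_3)=(1,1,2),\\ E_6,&\text{if }(m_1,m_2,m_3)=(1,2,2).\end{cases}$$ Moreover, $B^{\mathrm{tail}}$ is a reduced subdivisor of $\sum_{i\,:\,m_i=0}B_i'$. Conversely, every reduced subdivisor satisfying these conditions is an ADER.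
   Context: We work over an algebraically closed field of characteristic $0$. In a fiber of type $IV^*$ all components are smooth rational $(-2)$-curves, meeting transversely in at most one point, with dual graph $\widetilde E_6$: three branches $C-B_i-B_i'$ ($i=1,2,3$) start at the central vertex $C$. Since $\Gamma$ is connected and contains $C$, it contains exactly the first $m_i$ components of the $i$-th branch $B_i-B_i'$ for a well-defined $m_i\in\{0,1,2\}$. An ADE reduced divisor (ADER) in $F$ is a reduced subdivisor of $F$ (a sum of distinct components) whose dual graph is a disjoint union of Dynkin diagrams of type $A_k$, $D_l$ ($l\ge4$), $E_6,E_7,E_8$; its type is the type of this graph. $B^{\mathrm{tail}}=0$ is allowed. *)

theory Defs
  imports
    "HOL.Hull"
    "HOL-Library.FuncSet"
    "HOL-Combinatorics.Permutations"
    "HOL-Computational_Algebra.Polynomial"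
begin

text \<open>
  Integral varieties over a field \<open>k\<close> are treated in Zariski's language: the function field is a
  type \<open>'a\<close>, the base field \<open>k\<close> is a subfield of it, and a variety \<open>X\<close> is identified with the set
  of the local rings of its (scheme-theoretic) points, all of them subrings of \<open>'a\<close>.  A point
  \<open>Q\<close> is a generization of a point \<open>P\<close> iff \<open>P \<subseteq> Q\<close>; thus the closure of \<open>Q\<close> is
  \<open>{P \<in> X. P \<subseteq> Q}\<close>, and the generic point is \<open>UNIV\<close>.  An integral curve on a surface is identified
  with its generic point.
\<close>


section \<open>Subrings of a field\<close>

definition is_subring :: "'a::field set \<Rightarrow> bool" where
  "is_subring R \<longleftrightarrow> 1 \<in> R \<and> (\<forall>x\<in>R. \<forall>y\<in>R. x - y \<in> R \<and> x * y \<in> R)"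

definition is_subfield :: "'a::field set \<Rightarrow> bool" where
  "is_subfield E \<longleftrightarrow> is_subring E \<and> (\<forall>x\<in>E. inverse x \<in> E)"

definition is_ideal :: "'a::field set \<Rightarrow> 'a set \<Rightarrow> bool" where
  "is_ideal R I \<longleftrightarrow> I \<subseteq> R \<and> 0 \<in> I \<and> (\<forall>x\<in>I. \<forall>y\<in>I. x + y \<in> I) \<and> (\<forall>r\<in>R. \<forall>x\<in>I. r * x \<in> I)"

definition is_prime_ideal :: "'a::field set \<Rightarrow> 'a set \<Rightarrow> bool" where
  "is_prime_ideal R I \<longleftrightarrow>
     is_ideal R I \<and> 1 \<notin> I \<and> (\<forall>x\<in>R. \<forall>y\<in>R. x * y \<in> I \<longrightarrow> x \<in> I \<or> y \<in> I)"

definition localization :: "'a::field set \<Rightarrow> 'a set \<Rightarrow> 'a set" where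
  "localization R I = {x / s | x s. x \<in> R \<and> s \<in> R - I}"

text \<open>For a local ring this is the maximal ideal.\<close>

definition nonunits :: "'a::field set \<Rightarrow> 'a set" where
  "nonunits R = {x \<in> R. x = 0 \<or> inverse x \<notin> R}"

definition dominates :: "'a::field set \<Rightarrow> 'a set \<Rightarrow> bool" where
  "dominates S R \<longleftrightarrow> R \<subseteq> S \<and> nonunits R \<subseteq> nonunits S"

definition krull_dim_ge :: "'a::field set \<Rightarrow> nat \<Rightarrow> bool" where
  "krull_dim_ge R n \<longleftrightarrow>
     (\<exists>p. (\<forall>i\<le>n. is_prime_ideal R (p i)) \<and> (\<forall>i<n. p i \<subset> p (Suc i)))"

definition krull_dim_eq :: "'a::field set \<Rightarrow> nat \<Rightarrow> bool" where
  "krull_dim_eq R n \<longleftrightarrow> krull_dim_ge R n \<and> \<not> krull_dim_ge R (Suc n)"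

definition regular_local :: "'a::field set \<Rightarrow> bool" where
  "regular_local R \<longleftrightarrow>
     (\<exists>n G. krull_dim_eq R n \<and> finite G \<and> card G = n \<and> nonunits R = is_ideal R hull G)"

definition valuation_ring :: "'a::field set \<Rightarrow> 'a set \<Rightarrow> 'a set \<Rightarrow> bool" where
  "valuation_ring k E V \<longleftrightarrow>
     is_subring V \<and> k \<subseteq> V \<and> V \<subseteq> E \<and> (\<forall>x\<in>E. x \<in> V \<or> inverse x \<in> V)"

definition uniformizer :: "'a::field set \<Rightarrow> 'a \<Rightarrow> bool" where
  "uniformizer V t \<longleftrightarrow> t \<in> V \<and> nonunits V = (\<lambda>y. t * y) ` V"

text \<open>The normalized valuation of a nonzero element \<open>x\<close> of a discrete valuation ring \<open>V\<close>.\<close>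

definition ord_at :: "'a::field set \<Rightarrow> 'a \<Rightarrow> nat" where
  "ord_at V x = (THE n. \<exists>t u. uniformizer V t \<and> u \<in> V - nonunits V \<and> x = u * t ^ n)"


section \<open>Subfields\<close>

definition algebraic_over :: "'a::field set \<Rightarrow> 'a \<Rightarrow> bool" where
  "algebraic_over E x \<longleftrightarrow> (\<exists>p. p \<noteq> 0 \<and> set (coeffs p) \<subseteq> E \<and> poly p x = 0)"

definition alg_closed_subfield :: "'a::field set \<Rightarrow> bool" where
  "alg_closed_subfield k \<longleftrightarrow>
     is_subfield k \<and> (\<forall>p. set (coeffs p) \<subseteq> k \<and> degree p > 0 \<longrightarrow> (\<exists>x\<in>k. poly p x = 0))"

text \<open>\<open>E\<close> has a transcendence basis of \<open>n\<close> elements over \<open>k\<close>.\<close>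

definition trdeg_eq :: "'a::field set \<Rightarrow> 'a set \<Rightarrow> nat \<Rightarrow> bool" where
  "trdeg_eq k E n \<longleftrightarrow>
     (\<exists>T. T \<subseteq> E \<and> finite T \<and> card T = n \<and>
        (\<forall>t\<in>T. \<not> algebraic_over (is_subfield hull (k \<union> (T - {t}))) t) \<and>
        (\<forall>x\<in>E. algebraic_over (is_subfield hull (k \<union> T)) x))"


section \<open>Varieties\<close>

definition affine_model :: "'a::field set \<Rightarrow> 'a set set" where
  "affine_model A = {localization A p | p. is_prime_ideal A p}"

text \<open>
  A finite union of affine varieties with function field \<open>'a\<close>.  By the valuative criteria, the
  last condition says that the union is separated (uniqueness) and complete (existence).
\<close>

definition complete_variety :: "'a::field set \<Rightarrow> 'a set set \<Rightarrow> bool" where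
  "complete_variety k X \<longleftrightarrow>
     (\<exists>\<S>. finite \<S> \<and> (\<forall>S\<in>\<S>. finite S \<and> is_subfield hull (k \<union> S) = UNIV) \<and>
        X = (\<Union>S\<in>\<S>. affine_model (is_subring hull (k \<union> S)))) \<and>
     (\<forall>V. valuation_ring k UNIV V \<longrightarrow> (\<exists>!R. R \<in> X \<and> dominates V R))"

text \<open>
  \<open>k\<close> is going to be algebraically closed, so regularity is smoothness; moreover, complete smooth
  surfaces are projective.
\<close>

definition smooth_complete_surface :: "'a::field set \<Rightarrow> 'a set set \<Rightarrow> bool" where
  "smooth_complete_surface k X \<longleftrightarrow>
     complete_variety k X \<and> trdeg_eq k UNIV 2 \<and> (\<forall>R\<in>X. regular_local R)"

text \<open>
  Let \<open>\<K>\<close> be the constant sheaf of rational functions.  The next definition describes the global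
  sections of \<open>\<K>/\<O>\<close> on \<open>Y\<close> (a variety, or the generic fiber of a fibration) by their
  values modulo \<open>R\<close> at all points \<open>R\<close>; a basis of neighbourhoods of \<open>R\<close> is given by the sets
  \<open>{Q \<in> Y. S \<subseteq> Q}\<close> with \<open>S \<subseteq> R\<close> finite.  As \<open>\<K>\<close> is flasque, \<open>H\<^sup>1(Y, \<O>)\<close> is the cokernel of
  \<open>H\<^sup>0(Y, \<K>) \<rightarrow> H\<^sup>0(Y, \<K>/\<O>)\<close>, so a section has zero class in \<open>H\<^sup>1(Y, \<O>)\<close> iff it is induced by one
  rational function.
\<close>

definition principal_part :: "'a::field set set \<Rightarrow> ('a set \<Rightarrow> 'a) \<Rightarrow> bool" where
  "principal_part Y f \<longleftrightarrow>
     (\<forall>R\<in>Y. \<exists>S g. finite S \<and> S \<subseteq> R \<and> (\<forall>Q\<in>Y. S \<subseteq> Q \<longrightarrow> f Q - g \<in> Q))"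

definition zero_class :: "'a::field set set \<Rightarrow> ('a set \<Rightarrow> 'a) \<Rightarrow> bool" where
  "zero_class Y f \<longleftrightarrow> (\<exists>g. \<forall>R\<in>Y. f R - g \<in> R)"

definition H1_structure_sheaf_zero :: "'a::field set set \<Rightarrow> bool" where
  "H1_structure_sheaf_zero Y \<longleftrightarrow> (\<forall>f. principal_part Y f \<longrightarrow> zero_class Y f)"

definition H1_structure_sheaf_one_dim :: "'a::field set \<Rightarrow> 'a set set \<Rightarrow> bool" where
  "H1_structure_sheaf_one_dim E Y \<longleftrightarrow>
     (\<exists>s. principal_part Y s \<and> \<not> zero_class Y s \<and>
        (\<forall>f. principal_part Y f \<longrightarrow> (\<exists>c\<in>E. zero_class Y (\<lambda>R. f R - c * s R))))"

definition derivation :: "'a::field set \<Rightarrow> ('a \<Rightarrow> 'a) \<Rightarrow> bool" where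
  "derivation k \<delta> \<longleftrightarrow>
     (\<forall>x y. \<delta> (x + y) = \<delta> x + \<delta> y) \<and> (\<forall>x y. \<delta> (x * y) = x * \<delta> y + y * \<delta> x) \<and> (\<forall>x\<in>k. \<delta> x = 0)"

text \<open>The stalk at \<open>R\<close> of the tangent sheaf.\<close>

definition vector_fields_at :: "'a::field set \<Rightarrow> 'a set \<Rightarrow> ('a \<Rightarrow> 'a) set" where
  "vector_fields_at k R = {\<delta>. derivation k \<delta> \<and> \<delta> ` R \<subseteq> R}"

text \<open>Rational 2-forms on a surface, as alternating forms on rational vector fields.\<close>

definition rational_2form :: "'a::field set \<Rightarrow> (('a \<Rightarrow> 'a) \<Rightarrow> ('a \<Rightarrow> 'a) \<Rightarrow> 'a) \<Rightarrow> bool" where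
  "rational_2form k \<omega> \<longleftrightarrow>
     (\<forall>\<delta> \<epsilon> \<eta> f g. derivation k \<delta> \<and> derivation k \<epsilon> \<and> derivation k \<eta> \<longrightarrow>
        \<omega> \<delta> \<delta> = 0 \<and>
        \<omega> (\<lambda>x. f * \<delta> x + g * \<epsilon> x) \<eta> = f * \<omega> \<delta> \<eta> + g * \<omega> \<epsilon> \<eta> \<and>
        \<omega> \<eta> (\<lambda>x. f * \<delta> x + g * \<epsilon> x) = f * \<omega> \<eta> \<delta> + g * \<omega> \<eta> \<epsilon>)"

text \<open>
  On a smooth surface the stalk of the tangent sheaf at \<open>R\<close> is free of rank 2, and the values of
  \<open>\<omega>\<close> on it form the ideal \<open>g R\<close>, where \<open>\<omega>\<close> is \<open>g\<close> times a generator of the stalk of the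
  canonical sheaf.  Hence the condition says that some \<open>\<omega>\<close> has neither zeros nor poles.
\<close>

definition trivial_canonical_sheaf :: "'a::field set \<Rightarrow> 'a set set \<Rightarrow> bool" where
  "trivial_canonical_sheaf k X \<longleftrightarrow>
     (\<exists>\<omega>. rational_2form k \<omega> \<and>
        (\<forall>R\<in>X. {\<omega> \<delta> \<epsilon> | \<delta> \<epsilon>. \<delta> \<in> vector_fields_at k R \<and> \<epsilon> \<in> vector_fields_at k R} = R))"

definition K3_surface :: "'a::field set \<Rightarrow> 'a set set \<Rightarrow> bool" where
  "K3_surface k X \<longleftrightarrow>
     smooth_complete_surface k X \<and> trivial_canonical_sheaf k X \<and> H1_structure_sheaf_zero X"


section \<open>Elliptic fibrations\<close>

text \<open>
  A fibration of \<open>X\<close> over a smooth complete curve is given by the function field \<open>L\<close> of the curve,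
  whose points are the valuation rings of \<open>L\<close> over \<open>k\<close> (the generic point being \<open>L\<close> itself).
  The point \<open>R\<close> of \<open>X\<close> is mapped to \<open>R \<inter> L\<close>.  Connectedness of the fibers means that \<open>L\<close> is
  algebraically closed in the function field of \<open>X\<close>.
\<close>

definition fibration :: "'a::field set \<Rightarrow> 'a set set \<Rightarrow> 'a set \<Rightarrow> bool" where
  "fibration k X L \<longleftrightarrow>
     is_subfield L \<and> k \<subseteq> L \<and> trdeg_eq k L 1 \<and> (\<forall>x. algebraic_over L x \<longrightarrow> x \<in> L) \<and>
     (\<forall>R\<in>X. valuation_ring k L (R \<inter> L))"

definition generic_fiber :: "'a::field set set \<Rightarrow> 'a set \<Rightarrow> 'a set set" where
  "generic_fiber X L = {R \<in> X. L \<subseteq> R}"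

definition elliptic_fibration :: "'a::field set \<Rightarrow> 'a set set \<Rightarrow> 'a set \<Rightarrow> bool" where
  "elliptic_fibration k X L \<longleftrightarrow>
     fibration k X L \<and> H1_structure_sheaf_one_dim L (generic_fiber X L)"

definition closed_point_of_base :: "'a::field set \<Rightarrow> 'a set \<Rightarrow> 'a set \<Rightarrow> bool" where
  "closed_point_of_base k L V \<longleftrightarrow> valuation_ring k L V \<and> V \<noteq> L"

definition prime_divisor :: "'a::field set set \<Rightarrow> 'a set \<Rightarrow> bool" where
  "prime_divisor X D \<longleftrightarrow> D \<in> X \<and> krull_dim_eq D 1"

text \<open>
  The fiber over \<open>V\<close> as an effective divisor: the multiplicity of a prime divisor lying over \<open>V\<close>
  is the order along it of a local parameter of the base.
\<close>

definition fiber :: "'a::field set set \<Rightarrow> 'a set \<Rightarrow> 'a set \<Rightarrow> 'a set \<Rightarrow> nat" where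
  "fiber X L V D =
     (if prime_divisor X D \<and> D \<inter> L = V then ord_at D (SOME t. uniformizer V t) else 0)"

definition divisor_components :: "('a set \<Rightarrow> nat) \<Rightarrow> 'a set set" where
  "divisor_components F = {D. F D > 0}"


section \<open>Fibers of type \<open>IV\<^sup>*\<close>\<close>

text \<open>
  The local ring of the curve \<open>D\<close> at its point \<open>P\<close> is the quotient of \<open>P\<close> by
  \<open>P \<inter> nonunits D\<close>; its maximal ideal has to be principal.
\<close>

definition smooth_curve :: "'a::field set set \<Rightarrow> 'a set \<Rightarrow> bool" where
  "smooth_curve X D \<longleftrightarrow>
     (\<forall>P\<in>X. P \<subseteq> D \<longrightarrow>
        (\<exists>t\<in>nonunits P. \<forall>x\<in>nonunits P. \<exists>y\<in>P. x - t * y \<in> nonunits D))"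

text \<open>The residue field of \<open>D\<close> is purely transcendental over \<open>k\<close>, generated by the class of \<open>t\<close>.\<close>

definition rational_curve :: "'a::field set \<Rightarrow> 'a set \<Rightarrow> bool" where
  "rational_curve k D \<longleftrightarrow>
     (\<exists>t\<in>D. (\<forall>p. p \<noteq> 0 \<and> set (coeffs p) \<subseteq> k \<longrightarrow> poly p t \<notin> nonunits D) \<and>
        (\<forall>x\<in>D. \<exists>p q. set (coeffs p) \<subseteq> k \<and> set (coeffs q) \<subseteq> k \<and> q \<noteq> 0 \<and>
           poly q t * x - poly p t \<in> nonunits D))"

definition common_points :: "'a set set \<Rightarrow> 'a set \<Rightarrow> 'a set \<Rightarrow> 'a set set" where
  "common_points X D E = {P \<in> X. P \<subseteq> D \<and> P \<subseteq> E}"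

text \<open>Transversality at \<open>P\<close>: local equations of the two curves generate the maximal ideal of \<open>P\<close>.\<close>

definition meet_transversely_in_one_point :: "'a::field set set \<Rightarrow> 'a set \<Rightarrow> 'a set \<Rightarrow> bool" where
  "meet_transversely_in_one_point X D E \<longleftrightarrow>
     (\<exists>P. common_points X D E = {P} \<and>
        nonunits P = {x + y | x y. x \<in> P \<inter> nonunits D \<and> y \<in> P \<inter> nonunits E})"

definition disjoint_curves :: "'a set set \<Rightarrow> 'a set \<Rightarrow> 'a set \<Rightarrow> bool" where
  "disjoint_curves X D E \<longleftrightarrow> common_points X D E = {}"

text \<open>
  The three branches are numbered by 1, 2, 3.  That the components have self-intersection -2
  follows from the adjunction formula (or from \<open>F \<cdot> D = 0\<close>) and is not part of the definition.
\<close>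

definition fiber_of_type_IVstar ::
  "'a::field set \<Rightarrow> 'a set set \<Rightarrow> ('a set \<Rightarrow> nat) \<Rightarrow> 'a set \<Rightarrow> (nat \<Rightarrow> 'a set) \<Rightarrow> (nat \<Rightarrow> 'a set) \<Rightarrow> bool"
  where
  "fiber_of_type_IVstar k X F C B B' \<longleftrightarrow>
     distinct [C, B 1, B 2, B 3, B' 1, B' 2, B' 3] \<and>
     (\<forall>D. F D = 3 * of_bool (D = C) + 2 * (\<Sum>i\<in>{1,2,3}. of_bool (D = B i))
                + (\<Sum>i\<in>{1,2,3}. of_bool (D = B' i))) \<and>
     (\<forall>D\<in>divisor_components F. smooth_curve X D \<and> rational_curve k D) \<and>
     (\<forall>i\<in>{1,2,3}. meet_transversely_in_one_point X C (B i) \<and>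
                  meet_transversely_in_one_point X (B i) (B' i) \<and>
                  disjoint_curves X C (B' i)) \<and>
     (\<forall>i\<in>{1,2,3}. \<forall>j\<in>{1,2,3}. i \<noteq> j \<longrightarrow>
        disjoint_curves X (B i) (B j) \<and> disjoint_curves X (B i) (B' j) \<and>
        disjoint_curves X (B' i) (B' j))"


section \<open>ADE reduced divisors\<close>

text \<open>
  A reduced divisor is given by the set of its components.  Its dual graph has these components
  as vertices and the following adjacency relation; this is used only for curves that meet
  transversely in at most one point, where there are no multiple edges.
\<close>

definition adjacent :: "'a set set \<Rightarrow> 'a set \<Rightarrow> 'a set \<Rightarrow> bool" where
  "adjacent X D E \<longleftrightarrow> D \<noteq> E \<and> common_points X D E \<noteq> {}"

definition dual_graph_component :: "'a set set \<Rightarrow> 'a set set \<Rightarrow> 'a set \<Rightarrow> 'a set set" where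
  "dual_graph_component X R D = {E. (\<lambda>D E. D \<in> R \<and> E \<in> R \<and> adjacent X D E)\<^sup>*\<^sup>* D E}"

datatype dynkin = Type_A nat | Type_D nat | Type_E nat

fun dynkin_rank :: "dynkin \<Rightarrow> nat" where
  "dynkin_rank (Type_A n) = n"
| "dynkin_rank (Type_D n) = n"
| "dynkin_rank (Type_E n) = n"

fun valid_dynkin :: "dynkin \<Rightarrow> bool" where
  "valid_dynkin (Type_A n) \<longleftrightarrow> n \<ge> 1"
| "valid_dynkin (Type_D n) \<longleftrightarrow> n \<ge> 4"
| "valid_dynkin (Type_E n) \<longleftrightarrow> n \<in> {6, 7, 8}"

text \<open>
  The edges \<open>(i, j)\<close>, \<open>i < j\<close>, of the Dynkin diagrams on the vertices \<open>1, \<dots>, n\<close>: in types D and E,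
  the vertices \<open>1, \<dots>, n - 1\<close> form a chain, and \<open>n\<close> is attached to \<open>n - 2\<close> resp. \<open>n - 3\<close>.
\<close>

fun dynkin_edge :: "dynkin \<Rightarrow> nat \<Rightarrow> nat \<Rightarrow> bool" where
  "dynkin_edge (Type_A n) i j \<longleftrightarrow> j = i + 1"
| "dynkin_edge (Type_D n) i j \<longleftrightarrow> (j = i + 1 \<and> j < n) \<or> (i + 2 = n \<and> j = n)"
| "dynkin_edge (Type_E n) i j \<longleftrightarrow> (j = i + 1 \<and> j < n) \<or> (i + 3 = n \<and> j = n)"

definition is_of_type :: "'a set set \<Rightarrow> 'a set set \<Rightarrow> dynkin \<Rightarrow> bool" where
  "is_of_type X R T \<longleftrightarrow>
     valid_dynkin T \<and>
     (\<exists>\<phi>. bij_betw \<phi> R {1..dynkin_rank T} \<and>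
        (\<forall>D\<in>R. \<forall>E\<in>R. adjacent X D E \<longleftrightarrow>
           dynkin_edge T (\<phi> D) (\<phi> E) \<or> dynkin_edge T (\<phi> E) (\<phi> D)))"

definition ADER :: "'a set set \<Rightarrow> ('a set \<Rightarrow> nat) \<Rightarrow> 'a set set \<Rightarrow> bool" where
  "ADER X F R \<longleftrightarrow>
     R \<subseteq> divisor_components F \<and> (\<forall>D\<in>R. \<exists>T. is_of_type X (dual_graph_component X R D) T)"

text \<open>The divisor consisting of \<open>C\<close> and the first \<open>m i\<close> components of the \<open>i\<close>-th branch.\<close>

definition truncated_branches ::
  "'a set \<Rightarrow> (nat \<Rightarrow> 'a set) \<Rightarrow> (nat \<Rightarrow> 'a set) \<Rightarrow> (nat \<Rightarrow> nat) \<Rightarrow> 'a set set" where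
  "truncated_branches C B B' m =
     {C} \<union> {B i | i. i \<in> {1,2,3} \<and> m i \<ge> 1} \<union> {B' i | i. i \<in> {1,2,3} \<and> m i = 2}"

end

theory Submission
  imports Defs
begin

text \<open>
  Only the dual graph of the fiber matters.  A component \<open>B\<^sub>i'\<close> of \<open>R\<close> is adjacent in \<open>R\<close> at most to
  \<open>B\<^sub>i\<close>, so it is isolated unless \<open>B\<^sub>i\<close> belongs to \<open>R\<close>; this gives the shape of \<open>\<Gamma>\<close> and of the
  tail.  The types of the truncated trees are read off from explicit numberings of their
  vertices.  The full graph is excluded because in a Dynkin diagram each vertex of degree 3
  is adjacent to a leaf, whereas all neighbours of \<open>C\<close> in it have degree 2.
\<close>

section \<open>Numberings of dual graphs by Dynkin diagrams\<close>

lemma adjacent_sym: "adjacent X D E \<longleftrightarrow> adjacent X E D"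
  by (auto simp: adjacent_def common_points_def)

lemma not_adjacent_self: "\<not> adjacent X D D"
  by (simp add: adjacent_def)

text \<open>Turns a list of curves into a numbering: the entry at position \<open>i\<close> gets the
  label \<open>Suc i\<close>, since Dynkin vertices start at 1. Pairs with \<open>i < j\<close>
  suffice because adjacency is symmetric and irreflexive and \<open>dynkin_edge\<close> only relates
  a smaller label to a larger one.\<close>

lemma is_of_type_listI:
  assumes "valid_dynkin T" and "distinct xs" and "length xs = dynkin_rank T"
    and adj: "\<And>i j. i < j \<Longrightarrow> j < length xs \<Longrightarrow>
      adjacent X (xs ! i) (xs ! j) \<longleftrightarrow> dynkin_edge T (Suc i) (Suc j)"
  shows "is_of_type X (set xs) T"
proof -
  have edge_less: "i < j" if "dynkin_edge T i j" for i j
    using that by (cases T) auto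
  have "bij_betw (\<lambda>i. xs ! i) {..<length xs} (set xs)"
    using assms(2) by (rule bij_betw_nth) auto
  then obtain f where f: "bij_betw f (set xs) {..<length xs}"
    and f_nth: "\<And>i. i < length xs \<Longrightarrow> f (xs ! i) = i"
    by (metis bij_betw_inv_into bij_betw_inv_into_left lessThan_iff)
  have "bij_betw Suc {..<length xs} {1..dynkin_rank T}"
    by (simp add: assms(3) bij_betw_def image_Suc_lessThan)
  with f have bij: "bij_betw (Suc \<circ> f) (set xs) {1..dynkin_rank T}"
    by (rule bij_betw_trans)
  have "adjacent X D E \<longleftrightarrow>
      dynkin_edge T ((Suc \<circ> f) D) ((Suc \<circ> f) E) \<or> dynkin_edge T ((Suc \<circ> f) E) ((Suc \<circ> f) D)"
    if DE: "D \<in> set xs" "E \<in> set xs" for D E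
  proof -
    obtain i j where ij: "i < length xs" "D = xs ! i" "j < length xs" "E = xs ! j"
      using DE by (metis in_set_conv_nth)
    consider "i < j" | "i = j" | "j < i" by linarith
    then show ?thesis
      using ij f_nth adj[of i j] adj[of j i] edge_less[of "Suc i" "Suc j"] edge_less[of "Suc j" "Suc i"]
        adjacent_sym[of X D E] not_adjacent_self[of X D]
      by cases auto
  qed
  with assms(1) bij show ?thesis
    unfolding is_of_type_def by blast
qed

text \<open>In type A a vertex has at most two neighbours. In types D and E three distinct
  neighbours force \<open>p\<close> to be the branch vertex; then the extra vertex \<open>n\<close>
  is one of them, and its only neighbour is \<open>p\<close>.\<close>

lemma dynkin_trivalent_vertex_adjacent_to_leaf:
  assumes "dynkin_edge T p x \<or> dynkin_edge T x p"
    and "dynkin_edge T p y \<or> dynkin_edge T y p"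
    and "dynkin_edge T p z \<or> dynkin_edge T z p"
    and "distinct [x, y, z]"
  shows "\<exists>q\<in>{x, y, z}. \<forall>q'. dynkin_edge T q q' \<or> dynkin_edge T q' q \<longrightarrow> q' = p"
proof (cases T)
  case (Type_A n)
  then show ?thesis using assms by auto
next
  case (Type_D n)
  then have "n \<in> {x, y, z}" "p + 2 = n" using assms by auto
  with Type_D show ?thesis by (intro bexI[of _ n]) auto
next
  case (Type_E n)
  then have "n \<in> {x, y, z}" "p + 3 = n" using assms by auto
  with Type_E show ?thesis by (intro bexI[of _ n]) auto
qed

text \<open>Carries the leaf back along the numbering. The leaf property is relative to
  \<open>R\<close>, since adjacency to curves outside \<open>R\<close> is invisible to the
  numbering.\<close>

lemma type_trivalent_vertex_adjacent_to_leaf: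
  assumes type: "is_of_type X R T"
    and R: "P \<in> R" "D \<in> R" "E \<in> R" "G \<in> R"
    and adj: "adjacent X P D" "adjacent X P E" "adjacent X P G"
    and dist: "distinct [D, E, G]"
  shows "\<exists>Q\<in>{D, E, G}. \<forall>Q'\<in>R. adjacent X Q Q' \<longrightarrow> Q' = P"
proof -
  obtain f where f: "bij_betw f R {1..dynkin_rank T}"
    and f_adj: "\<And>D E. D \<in> R \<Longrightarrow> E \<in> R \<Longrightarrow> adjacent X D E \<longleftrightarrow>
           dynkin_edge T (f D) (f E) \<or> dynkin_edge T (f E) (f D)"
    using type unfolding is_of_type_def by blast
  have inj: "f Q = f Q' \<longleftrightarrow> Q = Q'" if "Q \<in> R" "Q' \<in> R" for Q Q'
    using f that by (auto simp: bij_betw_def inj_on_def)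
  have "\<exists>q\<in>{f D, f E, f G}. \<forall>q'. dynkin_edge T q q' \<or> dynkin_edge T q' q \<longrightarrow> q' = f P"
    using R adj dist by (intro dynkin_trivalent_vertex_adjacent_to_leaf) (auto simp: f_adj inj)
  then obtain Q where "Q \<in> {D, E, G}"
    and "\<forall>q'. dynkin_edge T (f Q) q' \<or> dynkin_edge T q' (f Q) \<longrightarrow> q' = f P"
    by auto
  then show ?thesis
    using R f_adj inj by (intro bexI[of _ Q]) auto
qed

section \<open>Connected components of dual graphs\<close>

lemma dual_graph_component_eqI:
  assumes conn: "\<And>E. E \<in> S \<Longrightarrow> (\<lambda>D E. D \<in> R \<and> E \<in> R \<and> adjacent X D E)\<^sup>*\<^sup>* D E"
    and "D \<in> S"
    and closed: "\<And>P Q. P \<in> S \<Longrightarrow> Q \<in> R \<Longrightarrow> adjacent X P Q \<Longrightarrow> Q \<in> S"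
  shows "dual_graph_component X R D = S"
proof -
  have "E \<in> S" if "(\<lambda>D E. D \<in> R \<and> E \<in> R \<and> adjacent X D E)\<^sup>*\<^sup>* D E" for E
    using that by induction (use \<open>D \<in> S\<close> closed in auto)
  with conn show ?thesis by (auto simp: dual_graph_component_def)
qed

text \<open>Adjacency is symmetric, so reachability is an equivalence relation. In the converse this
  transfers the component of \<open>C\<close> to every curve of the tree.\<close>

lemma dual_graph_component_eq:
  assumes "E \<in> dual_graph_component X R D"
  shows "dual_graph_component X R E = dual_graph_component X R D"
proof -
  let ?r = "\<lambda>D E. D \<in> R \<and> E \<in> R \<and> adjacent X D E"
  have "symp ?r\<^sup>*\<^sup>*"
    by (intro symp_rtranclp sympI) (simp add: adjacent_sym)
  then have "?r\<^sup>*\<^sup>* E D" "?r\<^sup>*\<^sup>* D E"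
    using assms by (auto simp: dual_graph_component_def dest: sympD)
  then show ?thesis
    by (auto simp: dual_graph_component_def)
qed

text \<open>Orders the branches by increasing length, so that only sorted triples have to be
  classified.\<close>

lemma sorted_triple:
  fixes m :: "nat \<Rightarrow> nat"
  shows "\<exists>a b c. {a, b, c} = {1, 2, 3::nat} \<and> distinct [a, b, c] \<and> m a \<le> m b \<and> m b \<le> m c"
proof -
  let ?P = "\<lambda>(a, b, c). {a, b, c} = {1, 2, 3::nat} \<and> distinct [a, b, c] \<and> m a \<le> m b \<and> m b \<le> m c"
  have "m 1 \<le> m 2 \<and> m 2 \<le> m 3 \<or> m 1 \<le> m 3 \<and> m 3 \<le> m 2 \<or> m 2 \<le> m 1 \<and> m 1 \<le> m 3 \<or>
      m 2 \<le> m 3 \<and> m 3 \<le> m 1 \<or> m 3 \<le> m 1 \<and> m 1 \<le> m 2 \<or> m 3 \<le> m 2 \<and> m 2 \<le> m 1"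
    by linarith
  then have "?P (1, 2, 3) \<or> ?P (1, 3, 2) \<or> ?P (2, 1, 3) \<or> ?P (2, 3, 1) \<or> ?P (3, 1, 2) \<or> ?P (3, 2, 1)"
    by (elim disjE) auto
  then show ?thesis by blast
qed

text \<open>Replaces the comprehensions in \<open>truncated_branches\<close> by conditionals, which
  simplification decides once the values of \<open>m\<close> are known.\<close>

lemma image_Collect_triple:
  "{f i | i. i \<in> {a, b, c} \<and> P i} =
     (if P a then {f a} else {}) \<union> (if P b then {f b} else {}) \<union> (if P c then {f c} else {})"
  by (simp split: if_splits) blast

section \<open>The affine graph of type E_6 and its truncated trees\<close>

text \<open>Retains only the distinctness of the seven components and their adjacency;
  multiplicities and transversality are forgotten.\<close>

locale E6_tilde =
  fixes X :: "'a::field set set" and C :: "'a set" and B B' :: "nat \<Rightarrow> 'a set"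
  assumes distinct: "distinct [C, B 1, B 2, B 3, B' 1, B' 2, B' 3]"
    and adjacent_C_B: "i \<in> {1,2,3} \<Longrightarrow> adjacent X C (B i)"
    and adjacent_C_B': "i \<in> {1,2,3} \<Longrightarrow> \<not> adjacent X C (B' i)"
    and adjacent_B_B: "i \<in> {1,2,3} \<Longrightarrow> j \<in> {1,2,3} \<Longrightarrow> \<not> adjacent X (B i) (B j)"
    and adjacent_B_B': "i \<in> {1,2,3} \<Longrightarrow> j \<in> {1,2,3} \<Longrightarrow> adjacent X (B i) (B' j) \<longleftrightarrow> i = j"
    and adjacent_B'_B': "i \<in> {1,2,3} \<Longrightarrow> j \<in> {1,2,3} \<Longrightarrow> \<not> adjacent X (B' i) (B' j)"
begin

abbreviation "tree \<equiv> truncated_branches C B B'"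

lemma adjacent_B_C: "i \<in> {1,2,3} \<Longrightarrow> adjacent X (B i) C"
  and adjacent_B'_C: "i \<in> {1,2,3} \<Longrightarrow> \<not> adjacent X (B' i) C"
  and adjacent_B'_B: "i \<in> {1,2,3} \<Longrightarrow> j \<in> {1,2,3} \<Longrightarrow> adjacent X (B' i) (B j) \<longleftrightarrow> i = j"
  using adjacent_C_B adjacent_C_B' adjacent_B_B' adjacent_sym by metis+

lemmas adjacent_simps = not_adjacent_self adjacent_C_B adjacent_C_B' adjacent_B_B adjacent_B_B'
  adjacent_B'_B' adjacent_B_C adjacent_B'_C adjacent_B'_B

lemma C_neq: "i \<in> {1,2,3} \<Longrightarrow> C \<noteq> B i" "i \<in> {1,2,3} \<Longrightarrow> C \<noteq> B' i"
  and B_eq: "i \<in> {1,2,3} \<Longrightarrow> j \<in> {1,2,3} \<Longrightarrow> B i = B j \<longleftrightarrow> i = j"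
  and B'_eq: "i \<in> {1,2,3} \<Longrightarrow> j \<in> {1,2,3} \<Longrightarrow> B' i = B' j \<longleftrightarrow> i = j"
  and B_neq_B': "i \<in> {1,2,3} \<Longrightarrow> j \<in> {1,2,3} \<Longrightarrow> B i \<noteq> B' j"
  \<comment> \<open>The indices are split into cases; distinctness of the reversed list supplies
    each inequation in the opposite orientation.\<close>
  by ((elim insertE emptyE; insert distinct iffD2[OF distinct_rev distinct]; simp)[1])+

lemmas vertex_simps = C_neq C_neq[symmetric] B_eq B'_eq B_neq_B' B_neq_B'[symmetric]

lemma C_in_tree: "C \<in> tree m"
  and B_in_tree: "i \<in> {1,2,3} \<Longrightarrow> m i \<ge> 1 \<Longrightarrow> B i \<in> tree m"
  and B'_in_tree: "i \<in> {1,2,3} \<Longrightarrow> m i = 2 \<Longrightarrow> B' i \<in> tree m"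
  unfolding truncated_branches_def by blast+

lemma tree_cases [consumes 1, case_names C B B']:
  assumes "D \<in> tree m"
  obtains "D = C" | i where "i \<in> {1,2,3}" "m i \<ge> 1" "D = B i" | i where "i \<in> {1,2,3}" "m i = 2" "D = B' i"
  using assms unfolding truncated_branches_def by (elim UnE CollectE exE conjE singletonE)

lemma B_in_tree_iff:
  assumes i: "i \<in> {1,2,3}"
  shows "B i \<in> tree m \<longleftrightarrow> m i \<ge> 1"
proof
  assume "B i \<in> tree m"
  then show "m i \<ge> 1"
    by (cases rule: tree_cases) (use i C_neq B_eq B_neq_B' in metis)+
qed (rule B_in_tree[OF i])

lemma B'_in_tree_iff:
  assumes i: "i \<in> {1,2,3}"
  shows "B' i \<in> tree m \<longleftrightarrow> m i = 2"
proof
  assume "B' i \<in> tree m"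
  then show "m i = 2"
    by (cases rule: tree_cases) (use i C_neq B'_eq B_neq_B' in metis)+
qed (rule B'_in_tree[OF i])

text \<open>Membership of \<open>B i\<close> and \<open>B' i\<close> in the tree tells the values 0,
  1 and 2 of \<open>m i\<close> apart; outside the index set both functions agree by
  extensionality.\<close>

lemma tree_inj:
  assumes "m \<in> {1,2,3} \<rightarrow>\<^sub>E {0,1,2}" "m' \<in> {1,2,3} \<rightarrow>\<^sub>E {0,1,2}" "tree m = tree m'"
  shows "m = m'"
proof (rule PiE_ext[OF assms(1,2)])
  fix i :: nat assume i: "i \<in> {1,2,3}"
  have "m i \<in> {0,1,2}" "m' i \<in> {0,1,2}"
    using i by (rule PiE_mem[OF assms(1)], rule PiE_mem[OF assms(2)])
  then have "m i \<le> 2" "m' i \<le> 2" by auto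
  moreover have "m i \<ge> 1 \<longleftrightarrow> m' i \<ge> 1" "m i = 2 \<longleftrightarrow> m' i = 2"
    by (simp_all only: B_in_tree_iff[OF i, symmetric] B'_in_tree_iff[OF i, symmetric] assms(3))
  ultimately show "m i = m' i" by presburger
qed

text \<open>\<open>m i\<close> counts the components of the branch that are joined to
  \<open>C\<close> inside \<open>R\<close>. Whatever is left over is some \<open>B' i\<close> cut
  off by the absence of \<open>B i\<close>.\<close>

lemma tree_tail_decomposition:
  assumes "R \<subseteq> {C} \<union> B ` {1,2,3} \<union> B' ` {1,2,3}" and "C \<in> R"
  obtains m where "m \<in> {1,2,3} \<rightarrow>\<^sub>E {0,1,2}" "tree m \<subseteq> R"
    "R - tree m \<subseteq> {B' i | i. i \<in> {1,2,3} \<and> m i = 0}"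
proof
  define m :: "nat \<Rightarrow> nat"
    \<comment> \<open>\<open>B i\<close> is tested first: if it is missing, the value is 0 even when
      \<open>B' i\<close> lies in \<open>R\<close>.\<close>
    where "m = (\<lambda>i\<in>{1,2,3}. if B i \<notin> R then 0 else if B' i \<notin> R then 1 else 2)"
  show "m \<in> {1,2,3} \<rightarrow>\<^sub>E {0,1,2}" by (auto simp: m_def)
  have B: "m i \<ge> 1 \<longleftrightarrow> B i \<in> R" and B': "m i = 2 \<longleftrightarrow> B i \<in> R \<and> B' i \<in> R" if "i \<in> {1,2,3}" for i
    using that by (auto simp: m_def)
  show "tree m \<subseteq> R"
  proof
    show "D \<in> R" if "D \<in> tree m" for D
      using that by (cases rule: tree_cases) (use B B' assms(2) in metis)+
  qed
  show "R - tree m \<subseteq> {B' i | i. i \<in> {1,2,3} \<and> m i = 0}"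
  proof
    fix D assume D: "D \<in> R - tree m"
    then consider "D = C" | i where "i \<in> {1,2,3}" "D = B i" | i where "i \<in> {1,2,3}" "D = B' i"
      using assms(1) by (elim DiffE) (drule subsetD, assumption, elim UnE singletonE imageE)
    then show "D \<in> {B' i | i. i \<in> {1,2,3} \<and> m i = 0}"
    proof cases
      case 1
      with D C_in_tree show ?thesis by simp
    next
      case (2 i)
      with D B[of i] B_in_tree[of i m] show ?thesis by simp
    next
      case (3 i)
      with D B[OF 3(1)] B'[OF 3(1)] B'_in_tree[of i m] have "\<not> m i \<ge> 1" by blast
      then have "m i = 0" by simp
      with 3 show ?thesis by blast
    qed
  qed
qed

text \<open>Walking out along the branches reaches the whole tree. No walk leaves it: a tail curve
  \<open>B' i\<close> could only be joined to it through \<open>B i\<close>, which is missing as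
  \<open>m i = 0\<close>.\<close>

lemma component_of_C:
  assumes "tree m \<subseteq> R" and tail: "R - tree m \<subseteq> {B' i | i. i \<in> {1,2,3} \<and> m i = 0}"
  shows "dual_graph_component X R C = tree m"
proof (rule dual_graph_component_eqI)
  let ?r = "\<lambda>D E. D \<in> R \<and> E \<in> R \<and> adjacent X D E"
  have B: "?r\<^sup>*\<^sup>* C (B i)" if "i \<in> {1,2,3}" "m i \<ge> 1" for i
    using assms(1) C_in_tree B_in_tree[of i m, OF that] adjacent_C_B[OF that(1)]
    by (intro r_into_rtranclp) blast
  have B': "?r\<^sup>*\<^sup>* C (B' i)" if i: "i \<in> {1,2,3}" "m i = 2" for i
  proof (rule rtranclp.rtrancl_into_rtrancl)
    show "?r\<^sup>*\<^sup>* C (B i)" using i by (intro B) auto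
    have "m i \<ge> 1" using i(2) by simp
    then show "?r (B i) (B' i)"
      using assms(1) B_in_tree[OF i(1)] B'_in_tree[of i m, OF i] adjacent_B_B'[OF i(1) i(1)] by blast
  qed
  show "?r\<^sup>*\<^sup>* C E" if "E \<in> tree m" for E
    using that by (cases rule: tree_cases) (use B B' in simp_all)
  show "Q \<in> tree m" if "P \<in> tree m" "Q \<in> R" "adjacent X P Q" for P Q
  proof (rule ccontr)
    assume "Q \<notin> tree m"
    with that tail obtain i where i: "i \<in> {1,2,3}" "m i = 0" "Q = B' i" by blast
    from \<open>P \<in> tree m\<close> show False
    proof (cases rule: tree_cases)
      case C
      with i that(3) adjacent_C_B' show False by blast
    next
      case (B j)
      with i that(3) adjacent_B_B'[of j i] show False by simp
    next
      case (B' j)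
      with i that(3) adjacent_B'_B'[of j i] show False by simp
    qed
  qed
qed (rule C_in_tree)

text \<open>The only neighbour of a tail curve \<open>B' i\<close> in the fiber is
  \<open>B i\<close>, and \<open>m i = 0\<close> keeps \<open>B i\<close> out of the tree, hence out
  of \<open>R\<close>.\<close>

lemma component_of_tail:
  assumes "tree m \<subseteq> R" and tail: "R - tree m \<subseteq> {B' i | i. i \<in> {1,2,3} \<and> m i = 0}"
    and D: "D \<in> R - tree m"
  shows "dual_graph_component X R D = {D}"
proof (rule dual_graph_component_eqI)
  obtain i where i: "i \<in> {1,2,3}" "m i = 0" "D = B' i" using D tail by blast
  show "Q \<in> {D}" if "P \<in> {D}" "Q \<in> R" "adjacent X P Q" for P Q
  proof (cases "Q \<in> tree m")
    case True
    then show ?thesis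
    proof (cases rule: tree_cases)
      case C
      with i that adjacent_B'_C show ?thesis by blast
    next
      case (B j)
      with i that adjacent_B'_B[of i j] show ?thesis by simp
    next
      case (B' j)
      with i that adjacent_B'_B'[of i j] show ?thesis by simp
    qed
  next
    case False
    with that tail obtain j where "j \<in> {1,2,3}" "Q = B' j" by blast
    with i that adjacent_B'_B'[of i j] show ?thesis by simp
  qed
qed auto

section \<open>Types of the truncated trees\<close>

lemma singleton_type: "is_of_type X {D} (Type_A 1)"
  using is_of_type_listI[of "Type_A 1" "[D]" X] by simp

lemma tree_eq:
  assumes "{a, b, c} = {1, 2, 3::nat}"
  shows "tree m = {C} \<union>
    ((if m a \<ge> 1 then {B a} else {}) \<union> (if m b \<ge> 1 then {B b} else {}) \<union> (if m c \<ge> 1 then {B c} else {})) \<union>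
    ((if m a = 2 then {B' a} else {}) \<union> (if m b = 2 then {B' b} else {}) \<union> (if m c = 2 then {B' c} else {}))"
  unfolding truncated_branches_def assms[symmetric] image_Collect_triple ..

text \<open>The lists follow the conventions of \<open>dynkin_edge\<close>. In type A the branches
  \<open>b\<close> and \<open>c\<close> form one chain through \<open>C\<close>. In types D and E,
  \<open>C\<close> stands at position \<open>n - 2\<close> resp. \<open>n - 3\<close> of a chain,
  and the last entry is the remaining neighbour of \<open>C\<close>.\<close>

lemma tree_type:
  assumes abc: "{a, b, c} = {1, 2, 3::nat}" "distinct [a, b, c]"
    and m: "m a \<le> m b" "m b \<le> m c" "m c \<le> 2"
  shows "m a = 0 \<Longrightarrow> is_of_type X (tree m) (Type_A (1 + m a + m b + m c))"
    and "(m a, m b, m c) = (1, 1, 1) \<Longrightarrow> is_of_type X (tree m) (Type_D 4)"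
    and "(m a, m b, m c) = (1, 1, 2) \<Longrightarrow> is_of_type X (tree m) (Type_D 5)"
    and "(m a, m b, m c) = (1, 2, 2) \<Longrightarrow> is_of_type X (tree m) (Type_E 6)"
proof -
  have neq: "a \<noteq> b" "a \<noteq> c" "b \<noteq> c"
    using abc by auto
  \<comment> \<open>Bounded quantifiers let \<open>All_less_Suc\<close> unroll the finite check of
    all pairs.\<close>
  have *: "is_of_type X (tree m) T"
    if "valid_dynkin T" "distinct xs" "length xs = dynkin_rank T" "tree m = set xs"
      "\<forall>j<length xs. \<forall>i<j. adjacent X (xs ! i) (xs ! j) \<longleftrightarrow> dynkin_edge T (Suc i) (Suc j)" for T xs
    using is_of_type_listI[of T xs X] that by auto
  \<comment> \<open>Folding states the index conditions with \<open>{a, b, c}\<close>, so that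
    simplification verifies them for the variables \<open>a\<close>, \<open>b\<close>,
    \<open>c\<close>.\<close>
  note graph_simps = neq neq[symmetric] vertex_simps[folded abc(1)]
    adjacent_simps[folded abc(1)] All_less_Suc numeral_eq_Suc
  show "is_of_type X (tree m) (Type_A (1 + m a + m b + m c))" if "m a = 0"
  proof -
    consider "m b = 0" "m c = 0" | "m b = 0" "m c = 1" | "m b = 0" "m c = 2"
      | "m b = 1" "m c = 1" | "m b = 1" "m c = 2" | "m b = 2" "m c = 2"
      using m by linarith
    then show ?thesis
    proof cases
      case 1
      with that show ?thesis
        by (intro *[of _ "[C]"]) (auto simp: tree_eq[OF abc(1)])
    next
      case 2
      with that show ?thesis
        by (intro *[of _ "[C, B c]"]) (auto simp: tree_eq[OF abc(1)] graph_simps)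
    next
      case 3
      with that show ?thesis
        by (intro *[of _ "[C, B c, B' c]"]) (auto simp: tree_eq[OF abc(1)] graph_simps)
    next
      case 4
      with that show ?thesis
        by (intro *[of _ "[B b, C, B c]"]) (auto simp: tree_eq[OF abc(1)] graph_simps)
    next
      case 5
      with that show ?thesis
        by (intro *[of _ "[B b, C, B c, B' c]"]) (auto simp: tree_eq[OF abc(1)] graph_simps)
    next
      case 6
      with that show ?thesis
        by (intro *[of _ "[B' b, B b, C, B c, B' c]"]) (auto simp: tree_eq[OF abc(1)] graph_simps)
    qed
  qed
  show "is_of_type X (tree m) (Type_D 4)" if "(m a, m b, m c) = (1, 1, 1)"
    using that by (intro *[of _ "[B a, C, B b, B c]"]) (auto simp: tree_eq[OF abc(1)] graph_simps)
  show "is_of_type X (tree m) (Type_D 5)" if "(m a, m b, m c) = (1, 1, 2)"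
    using that by (intro *[of _ "[B' c, B c, C, B a, B b]"]) (auto simp: tree_eq[OF abc(1)] graph_simps)
  show "is_of_type X (tree m) (Type_E 6)" if "(m a, m b, m c) = (1, 2, 2)"
    using that by (intro *[of _ "[B' b, B b, C, B c, B' c, B a]"])
      (auto simp: tree_eq[OF abc(1)] graph_simps)
qed

lemma full_tree_no_type:
  assumes m: "\<And>i. i \<in> {1,2,3} \<Longrightarrow> m i = 2"
  shows "\<not> is_of_type X (tree m) T"
proof
  assume type: "is_of_type X (tree m) T"
  have B: "B i \<in> tree m" and B': "B' i \<in> tree m" if "i \<in> {1,2,3}" for i
    using m[OF that] B_in_tree[OF that] B'_in_tree[OF that] by simp_all
  have "\<exists>Q\<in>{B 1, B 2, B 3}. \<forall>Q'\<in>tree m. adjacent X Q Q' \<longrightarrow> Q' = C"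
  proof (rule type_trivalent_vertex_adjacent_to_leaf[OF type C_in_tree])
    show "distinct [B 1, B 2, B 3]" using distinct by simp
  qed (simp_all only: B adjacent_C_B insert_iff simp_thms)
  then obtain i where i: "i \<in> {1,2,3}" and leaf: "\<forall>Q'\<in>tree m. adjacent X (B i) Q' \<longrightarrow> Q' = C"
    by blast
  \<comment> \<open>\<open>B' i\<close> is a further neighbour of \<open>B i\<close> in the full
    tree, so the leaf property would identify it with \<open>C\<close>.\<close>
  have "B' i = C"
    using leaf B'[OF i] adjacent_B_B'[OF i i] by blast
  with C_neq(2)[OF i] show False by simp
qed

lemma tree_has_type:
  assumes m: "m \<in> {1,2,3} \<rightarrow>\<^sub>E {0,1,2}" and not_full: "(m 1, m 2, m 3) \<noteq> (2, 2, 2)"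
  shows "\<exists>T. is_of_type X (tree m) T"
proof -
  obtain a b c where abc: "{a, b, c} = {1, 2, 3::nat}" "distinct [a, b, c]" "m a \<le> m b" "m b \<le> m c"
    using sorted_triple[of m] by (elim exE conjE)
  have "c \<in> {1,2,3}" unfolding abc(1)[symmetric] by simp
  then have "m c \<in> {0,1,2}" by (rule PiE_mem[OF m])
  then have "m c \<le> 2" by auto
  \<comment> \<open>If the least of the three values were 2, all of them would be 2.\<close>
  have "m a \<noteq> 2"
  proof
    assume "m a = 2"
    with abc(3,4) \<open>m c \<le> 2\<close> have "\<forall>i\<in>{a, b, c}. m i = 2" by simp
    then have "\<forall>i\<in>{1,2,3}. m i = 2" unfolding abc(1) .
    with not_full show False by simp
  qed
  with abc(3,4) \<open>m c \<le> 2\<close> consider "m a = 0" | "m a = 1" "m b = 1" "m c = 1"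
    | "m a = 1" "m b = 1" "m c = 2" | "m a = 1" "m b = 2" "m c = 2"
    by linarith
  then show ?thesis
    using tree_type[OF abc \<open>m c \<le> 2\<close>] by cases (simp; blast)+
qed

end

section \<open>Passage from the fiber to its dual graph\<close>

text \<open>A transverse intersection supplies a common point and disjointness excludes one. For
  equal indices, non-adjacency of a curve to itself comes from the requirement
  \<open>D \<noteq> E\<close> in \<open>adjacent\<close>.\<close>

lemma fiber_of_type_IVstar_E6_tilde:
  assumes "fiber_of_type_IVstar k X F C B B'"
  shows "E6_tilde X C B B'"
proof -
  have dist: "distinct [C, B 1, B 2, B 3, B' 1, B' 2, B' 3]"
    and branch: "\<forall>i\<in>{1,2,3}. meet_transversely_in_one_point X C (B i) \<and>
      meet_transversely_in_one_point X (B i) (B' i) \<and> disjoint_curves X C (B' i)"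
    and branches: "\<forall>i\<in>{1,2,3}. \<forall>j\<in>{1,2,3}. i \<noteq> j \<longrightarrow> disjoint_curves X (B i) (B j) \<and>
      disjoint_curves X (B i) (B' j) \<and> disjoint_curves X (B' i) (B' j)"
    using assms unfolding fiber_of_type_IVstar_def by - (elim conjE, assumption)+
  have meet: "common_points X D E \<noteq> {}" if "meet_transversely_in_one_point X D E" for D E
    using that unfolding meet_transversely_in_one_point_def by (elim exE conjE) simp
  have "\<forall>i\<in>{1,2,3}. C \<noteq> B i" "\<forall>i\<in>{1,2,3}. B i \<noteq> B' i"
    using dist by simp_all
  note neq = this[THEN bspec]
  show ?thesis
  proof
    show "distinct [C, B 1, B 2, B 3, B' 1, B' 2, B' 3]" by (rule dist)
    fix i :: nat
    assume i: "i \<in> {1,2,3}"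
    note branch_i = bspec[OF branch i, unfolded disjoint_curves_def]
    show "adjacent X C (B i)" "\<not> adjacent X C (B' i)"
      using neq(1)[OF i] branch_i meet unfolding adjacent_def by blast+
    have adj: "adjacent X (B i) (B' i)"
      using neq(2)[OF i] branch_i meet unfolding adjacent_def by blast
    fix j :: nat
    assume j: "j \<in> {1,2,3}"
    note branches_ij = bspec[OF bspec[OF branches i] j, unfolded disjoint_curves_def]
    show "\<not> adjacent X (B i) (B j)" "\<not> adjacent X (B' i) (B' j)"
      using branches_ij unfolding adjacent_def by blast+
    show "adjacent X (B i) (B' j) \<longleftrightarrow> i = j"
      using branches_ij adj unfolding adjacent_def by blast
  qed
qed

lemma fiber_of_type_IVstar_components:
  assumes "fiber_of_type_IVstar k X F C B B'"
  shows "divisor_components F = {C} \<union> B ` {1,2,3} \<union> B' ` {1,2,3}"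
proof -
  have F: "F D = 3 * of_bool (D = C) + 2 * (\<Sum>i\<in>{1,2,3}. of_bool (D = B i))
                + (\<Sum>i\<in>{1,2,3}. of_bool (D = B' i))" for D
    using assms unfolding fiber_of_type_IVstar_def by (elim conjE) (erule spec)
  show ?thesis
    unfolding divisor_components_def
  proof (intro set_eqI, unfold mem_Collect_eq F)
    fix D
    \<comment> \<open>Deleting \<open>sum_of_bool_eq\<close> keeps the sum from becoming a
      cardinality; it expands to three terms whose positivity can be read off.\<close>
    have sum: "(\<Sum>i\<in>{1,2,3}. of_bool (D = G i)) = (of_bool (D = G 1) + of_bool (D = G 2) + of_bool (D = G 3) :: nat)"
      for G :: "nat \<Rightarrow> 'a set"
      by (simp del: sum_of_bool_eq)
    show "0 < 3 * of_bool (D = C) + 2 * (\<Sum>i\<in>{1,2,3}. of_bool (D = B i))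
        + (\<Sum>i\<in>{1,2,3}. of_bool (D = B' i) :: nat) \<longleftrightarrow>
      D \<in> {C} \<union> B ` {1,2,3} \<union> B' ` {1,2,3}"
      unfolding sum by simp blast
  qed
qed

theorem proposition14p2:
  fixes k L V C :: "'a::field_char_0 set"
    and X :: "'a set set"
    and B B' :: "nat \<Rightarrow> 'a set"
    and F :: "'a set \<Rightarrow> nat"
  assumes "alg_closed_subfield k"
    and "K3_surface k X"
    and "elliptic_fibration k X L"
    and "closed_point_of_base k L V"
    and "F = fiber X L V"
    and "fiber_of_type_IVstar k X F C B B'"
  shows "(\<forall>R \<Gamma>. ADER X F R \<and> C \<in> R \<and> \<Gamma> = dual_graph_component X R C \<longrightarrow>
           (\<exists>!m. m \<in> {1,2,3} \<rightarrow>\<^sub>E {0,1,2} \<and> \<Gamma> = truncated_branches C B B' m) \<and>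
           (\<forall>m\<in>{1,2,3} \<rightarrow>\<^sub>E {0,1,2}. \<forall>\<sigma> m1 m2 m3.
              \<Gamma> = truncated_branches C B B' m \<and>
              \<sigma> permutes {1,2,3} \<and> m1 = m (\<sigma> 1) \<and> m2 = m (\<sigma> 2) \<and> m3 = m (\<sigma> 3) \<and>
              m1 \<le> m2 \<and> m2 \<le> m3 \<longrightarrow>
                (m1, m2, m3) \<noteq> (2, 2, 2) \<and>
                (card {i \<in> {1,2,3}. m i \<noteq> 0} \<le> 2 \<longrightarrow> is_of_type X \<Gamma> (Type_A (1 + m1 + m2 + m3))) \<and>
                ((m1, m2, m3) = (1, 1, 1) \<longrightarrow> is_of_type X \<Gamma> (Type_D 4)) \<and>
                ((m1, m2, m3) = (1, 1, 2) \<longrightarrow> is_of_type X \<Gamma> (Type_D 5)) \<and>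
                ((m1, m2, m3) = (1, 2, 2) \<longrightarrow> is_of_type X \<Gamma> (Type_E 6)) \<and>
                R - \<Gamma> \<subseteq> {B' i | i. i \<in> {1,2,3} \<and> m i = 0})) \<and>
         (\<forall>m\<in>{1,2,3} \<rightarrow>\<^sub>E {0,1,2}. \<forall>R Btail.
           (m 1, m 2, m 3) \<noteq> (2, 2, 2) \<and>
           Btail \<subseteq> {B' i | i. i \<in> {1,2,3} \<and> m i = 0} \<and>
           R = truncated_branches C B B' m \<union> Btail \<longrightarrow> ADER X F R)"
proof -
  interpret E6_tilde X C B B'
    using assms(6) by (rule fiber_of_type_IVstar_E6_tilde)
  note components = fiber_of_type_IVstar_components[OF assms(6)]
  show ?thesis
  proof (rule conjI; intro allI ballI impI)
    fix R \<Gamma>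
    assume R: "ADER X F R \<and> C \<in> R \<and> \<Gamma> = dual_graph_component X R C"
    then have "R \<subseteq> {C} \<union> B ` {1,2,3} \<union> B' ` {1,2,3}" and C: "C \<in> R"
      and \<Gamma>_eq: "\<Gamma> = dual_graph_component X R C"
      and types: "\<forall>D\<in>R. \<exists>T. is_of_type X (dual_graph_component X R D) T"
      unfolding ADER_def components by - (elim conjE, assumption)+
    then obtain m where m: "m \<in> {1,2,3} \<rightarrow>\<^sub>E {0,1,2}" "tree m \<subseteq> R"
      and tail: "R - tree m \<subseteq> {B' i | i. i \<in> {1,2,3} \<and> m i = 0}"
      by (elim tree_tail_decomposition)
    have \<Gamma>: "\<Gamma> = tree m"
      unfolding \<Gamma>_eq by (rule component_of_C[OF m(2) tail])
    \<comment> \<open>Which type this is does not matter: the existence of some type excludes the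
      full tree.\<close>
    obtain T where T: "is_of_type X \<Gamma> T"
      using bspec[OF types C] unfolding \<Gamma>_eq ..
    show "(\<exists>!m. m \<in> {1,2,3} \<rightarrow>\<^sub>E {0,1,2} \<and> \<Gamma> = tree m) \<and>
           (\<forall>m\<in>{1,2,3} \<rightarrow>\<^sub>E {0,1,2}. \<forall>\<sigma> m1 m2 m3.
              \<Gamma> = tree m \<and>
              \<sigma> permutes {1,2,3} \<and> m1 = m (\<sigma> 1) \<and> m2 = m (\<sigma> 2) \<and> m3 = m (\<sigma> 3) \<and>
              m1 \<le> m2 \<and> m2 \<le> m3 \<longrightarrow>
                (m1, m2, m3) \<noteq> (2, 2, 2) \<and>
                (card {i \<in> {1,2,3}. m i \<noteq> 0} \<le> 2 \<longrightarrow> is_of_type X \<Gamma> (Type_A (1 + m1 + m2 + m3))) \<and>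
                ((m1, m2, m3) = (1, 1, 1) \<longrightarrow> is_of_type X \<Gamma> (Type_D 4)) \<and>
                ((m1, m2, m3) = (1, 1, 2) \<longrightarrow> is_of_type X \<Gamma> (Type_D 5)) \<and>
                ((m1, m2, m3) = (1, 2, 2) \<longrightarrow> is_of_type X \<Gamma> (Type_E 6)) \<and>
                R - \<Gamma> \<subseteq> {B' i | i. i \<in> {1,2,3} \<and> m i = 0})"
    proof (intro conjI ballI allI impI)
      show "\<exists>!m. m \<in> {1,2,3} \<rightarrow>\<^sub>E {0,1,2} \<and> \<Gamma> = tree m"
      proof (rule ex1I[of _ m])
        show "m \<in> {1,2,3} \<rightarrow>\<^sub>E {0,1,2} \<and> \<Gamma> = tree m" using m(1) \<Gamma> by (rule conjI)
        show "m' = m" if "m' \<in> {1,2,3} \<rightarrow>\<^sub>E {0,1,2} \<and> \<Gamma> = tree m'" for m'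
          using that \<Gamma> tree_inj[OF _ m(1), of m'] by metis
      qed
    next
      fix m' \<sigma> m1 m2 m3
      assume m': "m' \<in> {1,2,3} \<rightarrow>\<^sub>E {0,1,2}"
        and *: "\<Gamma> = tree m' \<and>
              \<sigma> permutes {1,2,3} \<and> m1 = m' (\<sigma> 1) \<and> m2 = m' (\<sigma> 2) \<and> m3 = m' (\<sigma> 3) \<and>
              m1 \<le> m2 \<and> m2 \<le> m3"
      \<comment> \<open>By uniqueness the given function is the one found by the decomposition, so
        the facts about \<open>m\<close> apply to it.\<close>
      have "m' = m" using tree_inj[OF m' m(1)] * \<Gamma> by simp
      have \<sigma>: "\<sigma> permutes {1,2,3}" using * by simp
      \<comment> \<open>The values of \<open>\<sigma>\<close> serve as the sorted indices
        \<open>a\<close>, \<open>b\<close>, \<open>c\<close> of \<open>tree_type\<close>.\<close>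
      have abc: "{\<sigma> 1, \<sigma> 2, \<sigma> 3} = {1,2,3}"
        using permutes_image[OF \<sigma>] by simp
      have dist: "distinct [\<sigma> 1, \<sigma> 2, \<sigma> 3]"
        using permutes_inj[OF \<sigma>] by (simp add: inj_eq)
      have "\<sigma> 3 \<in> {1,2,3}" unfolding abc[symmetric] by simp
      then have "m (\<sigma> 3) \<in> {0,1,2}" by (rule PiE_mem[OF m(1)])
      then have le: "m (\<sigma> 3) \<le> 2" by auto
      have ord: "m (\<sigma> 1) \<le> m (\<sigma> 2)" "m (\<sigma> 2) \<le> m (\<sigma> 3)" using * \<open>m' = m\<close> by auto
      note types = tree_type[OF abc dist ord le]
      show "(m1, m2, m3) \<noteq> (2, 2, 2)"
      proof
        assume "(m1, m2, m3) = (2, 2, 2)"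
        then have "\<forall>i\<in>{\<sigma> 1, \<sigma> 2, \<sigma> 3}. m i = 2" using * \<open>m' = m\<close> by simp
        then have "\<forall>i\<in>{1,2,3}. m i = 2" unfolding abc .
        then have "\<not> is_of_type X (tree m) T" by (intro full_tree_no_type) (rule bspec)
        with T \<Gamma> show False by simp
      qed
      show "is_of_type X \<Gamma> (Type_A (1 + m1 + m2 + m3))" if "card {i \<in> {1,2,3}. m' i \<noteq> 0} \<le> 2"
      proof -
        \<comment> \<open>This is the least value; if it were nonzero, all three would be, and the
          counted set would have three elements.\<close>
        have "m (\<sigma> 1) = 0"
        proof (rule ccontr)
          assume "m (\<sigma> 1) \<noteq> 0"
          with ord have "\<forall>i\<in>{\<sigma> 1, \<sigma> 2, \<sigma> 3}. m i \<noteq> 0" by simp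
          then have "\<forall>i\<in>{1,2,3}. m i \<noteq> 0" unfolding abc .
          moreover have "{i \<in> A. m i \<noteq> 0} = A" if "\<forall>i\<in>A. m i \<noteq> 0" for A
            using that by blast
          ultimately have "{i \<in> {1,2,3}. m i \<noteq> 0} = {1,2,3}" by blast
          with that \<open>m' = m\<close> show False by simp
        qed
        with types(1) show ?thesis using * \<open>m' = m\<close> by simp
      qed
      show "is_of_type X \<Gamma> (Type_D 4)" if "(m1, m2, m3) = (1, 1, 1)"
        using types(2) that * \<open>m' = m\<close> by simp
      show "is_of_type X \<Gamma> (Type_D 5)" if "(m1, m2, m3) = (1, 1, 2)"
        using types(3) that * \<open>m' = m\<close> by simp
      show "is_of_type X \<Gamma> (Type_E 6)" if "(m1, m2, m3) = (1, 2, 2)"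
        using types(4) that * \<open>m' = m\<close> by simp
      show "R - \<Gamma> \<subseteq> {B' i | i. i \<in> {1,2,3} \<and> m' i = 0}"
        using tail \<Gamma> \<open>m' = m\<close> by simp
    qed
  next
    fix m R Btail
    assume m: "m \<in> {1,2,3} \<rightarrow>\<^sub>E {0,1,2}"
      and *: "(m 1, m 2, m 3) \<noteq> (2, 2, 2) \<and>
           Btail \<subseteq> {B' i | i. i \<in> {1,2,3} \<and> m i = 0} \<and> R = tree m \<union> Btail"
    then have R: "tree m \<subseteq> R" and tail: "R - tree m \<subseteq> {B' i | i. i \<in> {1,2,3} \<and> m i = 0}"
      by blast+
    have "tree m \<subseteq> divisor_components F"
      unfolding components
    proof
      show "D \<in> {C} \<union> B ` {1,2,3} \<union> B' ` {1,2,3}" if "D \<in> tree m" for D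
        using that by (cases rule: tree_cases) (simp_all only: UnI1 UnI2 imageI singletonI)
    qed
    moreover have "Btail \<subseteq> divisor_components F"
    proof -
      have "{B' i | i. i \<in> I \<and> m i = 0} \<subseteq> B' ` I" for I by blast
      with * show ?thesis unfolding components by (meson subset_trans sup_ge2)
    qed
    \<comment> \<open>A curve of the tree has the whole tree as its component; a tail curve is
      isolated and so of type \<open>A_1\<close>.\<close>
    moreover have "\<exists>T. is_of_type X (dual_graph_component X R D) T" if "D \<in> R" for D
    proof (cases "D \<in> tree m")
      case True
      then have "dual_graph_component X R D = tree m"
        using component_of_C[OF R tail] dual_graph_component_eq by metis
      then show ?thesis using tree_has_type[OF m] * by simp
    next
      case False
      with that have "dual_graph_component X R D = {D}"
        by (intro component_of_tail[OF R tail]) auto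
      then show ?thesis using singleton_type by auto
    qed
    ultimately show "ADER X F R" using * by (auto simp: ADER_def)
  qed
qed

end
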